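(* Let $(C,\Delta,\varepsilon)$ be a coalgebra, let $\lambda\in\mathbb{K}$, let $P:C\to C$ be a linear operator, and put $\overline{P}=-\lambda\,\mathrm{id}-P$. If $P$ is a Rota-Baxter operator of weight $\lambda$, then there is a linear map $\Phi:C\to C\otimes C$ such that $$(P\otimes P)\Delta=\Phi P\qquad\text{and}\qquad(\overline{P}\otimes\overline{P})\Delta=-\Phi\overline{P}.$$ If $\lambda\neq 0$, then the converse is also true: if there is a linear map $\Phi:C\to C\otimes C$ satisfying these two identities, then $P$ is a Rota-Baxter operator of weight $\lambda$.
   Context: $\mathbb{K}$ is a fixed ground field of characteristic 0; all vector spaces, coalgebras and tensor products are over $\mathbb{K}$. A Rota-Baxter operator of weight $\lambda\in\mathbb{K}$ on a coalgebra $(C,\Delta,\varepsilon)$ is a linear map $P:C\to C$ such that $(P\otimes P)\Delta=(\mathrm{id}\otimes P)\Delta P+(P\otimes\mathrm{id})\Delta P+\lambda\Delta P$. *)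

theory Defs
  imports "HOL-Algebra.Module" "HOL-Algebra.AbelCoset"
begin

definition char_zero :: "('k, 'r) ring_scheme \<Rightarrow> bool"
  where "char_zero K \<longleftrightarrow> (\<forall>n::nat. n > 0 \<longrightarrow> add_pow K n \<one>\<^bsub>K\<^esub> \<noteq> \<zero>\<^bsub>K\<^esub>)"

text \<open>Vector spaces over a field \<open>K\<close> are the \<^locale>\<open>module\<close>s over \<open>K\<close>. The record type
  \<^typ>\<open>('k, 'a) module\<close> extends rings, so it has fields for a multiplication and a unit; these
  play no role for modules and are left \<^const>\<open>undefined\<close> in the constructions below.\<close>

definition lin_maps ::
    "('k, 'r) ring_scheme \<Rightarrow> ('k, 'a, 'm) module_scheme \<Rightarrow> ('k, 'b, 'n) module_scheme \<Rightarrow> ('a \<Rightarrow> 'b) set"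
  where "lin_maps K M N = {f \<in> carrier M \<rightarrow> carrier N.
    (\<forall>x\<in>carrier M. \<forall>y\<in>carrier M. f (x \<oplus>\<^bsub>M\<^esub> y) = f x \<oplus>\<^bsub>N\<^esub> f y) \<and>
    (\<forall>a\<in>carrier K. \<forall>x\<in>carrier M. f (a \<odot>\<^bsub>M\<^esub> x) = a \<odot>\<^bsub>N\<^esub> f x)}"

definition bilinear_maps ::
    "('k, 'r) ring_scheme \<Rightarrow> ('k, 'a, 'm) module_scheme \<Rightarrow> ('k, 'b, 'n) module_scheme
      \<Rightarrow> ('k, 'c, 'l) module_scheme \<Rightarrow> ('a \<Rightarrow> 'b \<Rightarrow> 'c) set"
  where "bilinear_maps K M N L = {\<beta>.
    (\<forall>y\<in>carrier N. (\<lambda>x. \<beta> x y) \<in> lin_maps K M L) \<and>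
    (\<forall>x\<in>carrier M. \<beta> x \<in> lin_maps K N L)}"

definition regular_module :: "('k, 'r) ring_scheme \<Rightarrow> ('k, 'k) module"
  where "regular_module K =
    \<lparr>carrier = carrier K, mult = mult K, one = one K, zero = zero K, add = add K, smult = mult K\<rparr>"

definition free_module :: "('k, 'r) ring_scheme \<Rightarrow> 'a set \<Rightarrow> ('k, 'a \<Rightarrow> 'k) module"
  where "free_module K A =
    \<lparr>carrier = {u. (\<forall>p. u p \<in> carrier K) \<and> (\<forall>p. p \<notin> A \<longrightarrow> u p = \<zero>\<^bsub>K\<^esub>) \<and> finite {p. u p \<noteq> \<zero>\<^bsub>K\<^esub>}},
     mult = undefined, one = undefined,
     zero = (\<lambda>_. \<zero>\<^bsub>K\<^esub>), add = (\<lambda>u v p. u p \<oplus>\<^bsub>K\<^esub> v p), smult = (\<lambda>a u p. a \<otimes>\<^bsub>K\<^esub> u p)\<rparr>"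

definition free_gen :: "('k, 'r) ring_scheme \<Rightarrow> 'a \<Rightarrow> 'a \<Rightarrow> 'k"
  where "free_gen K p = (\<lambda>q. if q = p then \<one>\<^bsub>K\<^esub> else \<zero>\<^bsub>K\<^esub>)"

definition submodule_generated ::
    "('k, 'r) ring_scheme \<Rightarrow> ('k, 'a, 'm) module_scheme \<Rightarrow> 'a set \<Rightarrow> 'a set"
  where "submodule_generated K M S = \<Inter> {H. submodule H K M \<and> S \<subseteq> H}"

definition quotient_module :: "('k, 'a, 'm) module_scheme \<Rightarrow> 'a set \<Rightarrow> ('k, 'a set) module"
  where "quotient_module M H =
    \<lparr>carrier = a_rcosets\<^bsub>M\<^esub> H, mult = undefined, one = undefined,
     zero = H, add = set_add M, smult = (\<lambda>a X. \<Union>x\<in>X. H +>\<^bsub>M\<^esub> (a \<odot>\<^bsub>M\<^esub> x))\<rparr>"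

type_synonym ('k, 'a, 'b) tensor = "('a \<times> 'b \<Rightarrow> 'k) set"

context
  fixes K :: "('k, 'r) ring_scheme" and M :: "('k, 'a, 'm) module_scheme"
    and N :: "('k, 'b, 'n) module_scheme"
begin

definition tensor_relations :: "('a \<times> 'b \<Rightarrow> 'k) set"
  where "tensor_relations = (let F = free_module K (carrier M \<times> carrier N); e = free_gen K in
    {e (x \<oplus>\<^bsub>M\<^esub> x', y) \<ominus>\<^bsub>F\<^esub> (e (x, y) \<oplus>\<^bsub>F\<^esub> e (x', y)) | x x' y.
        x \<in> carrier M \<and> x' \<in> carrier M \<and> y \<in> carrier N} \<union>
    {e (x, y \<oplus>\<^bsub>N\<^esub> y') \<ominus>\<^bsub>F\<^esub> (e (x, y) \<oplus>\<^bsub>F\<^esub> e (x, y')) | x y y'.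
        x \<in> carrier M \<and> y \<in> carrier N \<and> y' \<in> carrier N} \<union>
    {e (a \<odot>\<^bsub>M\<^esub> x, y) \<ominus>\<^bsub>F\<^esub> (a \<odot>\<^bsub>F\<^esub> e (x, y)) | a x y.
        a \<in> carrier K \<and> x \<in> carrier M \<and> y \<in> carrier N} \<union>
    {e (x, a \<odot>\<^bsub>N\<^esub> y) \<ominus>\<^bsub>F\<^esub> (a \<odot>\<^bsub>F\<^esub> e (x, y)) | a x y.
        a \<in> carrier K \<and> x \<in> carrier M \<and> y \<in> carrier N})"

definition tensor_null :: "('a \<times> 'b \<Rightarrow> 'k) set"
  where "tensor_null = submodule_generated K (free_module K (carrier M \<times> carrier N)) tensor_relations"

definition tensor_product :: "('k, ('k, 'a, 'b) tensor) module"
  where "tensor_product = quotient_module (free_module K (carrier M \<times> carrier N)) tensor_null"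

definition pure_tensor :: "'a \<Rightarrow> 'b \<Rightarrow> ('k, 'a, 'b) tensor"
  where "pure_tensor x y =
    tensor_null +>\<^bsub>free_module K (carrier M \<times> carrier N)\<^esub> free_gen K (x, y)"

text \<open>The linear map on the tensor product induced by a bilinear map, restricted to the carrier
  so that it is uniquely determined; see \<open>ex1_tensor_lift\<close> below.\<close>

definition tensor_lift ::
    "('k, 'c, 'l) module_scheme \<Rightarrow> ('a \<Rightarrow> 'b \<Rightarrow> 'c) \<Rightarrow> ('k, 'a, 'b) tensor \<Rightarrow> 'c"
  where "tensor_lift L \<beta> = (THE h. h \<in> lin_maps K tensor_product L \<and>
    h \<in> extensional (carrier tensor_product) \<and>
    (\<forall>x\<in>carrier M. \<forall>y\<in>carrier N. h (pure_tensor x y) = \<beta> x y))"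

end

lemma free_module_module:
  fixes K :: "('k, 'r) ring_scheme" and A :: "'a set"
  assumes "cring K" shows "module K (free_module K A)"
proof -
  interpret cring K by fact
  have fin: "finite {p. u p \<oplus>\<^bsub>K\<^esub> v p \<noteq> \<zero>\<^bsub>K\<^esub>}"
    if "finite {p. u p \<noteq> \<zero>\<^bsub>K\<^esub>}" "finite {p. v p \<noteq> \<zero>\<^bsub>K\<^esub>}" for u v :: "'a \<Rightarrow> _"
    by (rule finite_subset[OF _ finite_UnI[OF that]]) auto
  have fin2: "finite {p. a \<otimes>\<^bsub>K\<^esub> u p \<noteq> \<zero>\<^bsub>K\<^esub>}"
    if "finite {p. u p \<noteq> \<zero>\<^bsub>K\<^esub>}" "a \<in> carrier K" for a and u :: "'a \<Rightarrow> _"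
    by (rule finite_subset[OF _ that(1)]) (use that(2) in auto)
  show ?thesis
  proof (rule moduleI[OF assms])
    show "abelian_group (free_module K A)"
    proof (rule abelian_groupI)
      fix x assume x: "x \<in> carrier (free_module K A)"
      show "\<exists>y\<in>carrier (free_module K A). y \<oplus>\<^bsub>free_module K A\<^esub> x = \<zero>\<^bsub>free_module K A\<^esub>"
        by (rule bexI[of _ "\<lambda>p. \<ominus>\<^bsub>K\<^esub> x p"])
          (use x in \<open>auto simp: free_module_def l_neg intro: rev_finite_subset\<close>)
    qed (auto simp: free_module_def a_ac fin)
  qed (auto simp: free_module_def fin fin2 l_distr r_distr m_assoc)
qed

lemma free_gen_closed:
  assumes "cring K" "p \<in> A" shows "free_gen K p \<in> carrier (free_module K A)"
proof -
  interpret cring K by fact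
  show ?thesis using assms by (auto simp: free_module_def free_gen_def)
qed

lemma submodule_generated_submodule:
  assumes "module K M" "S \<subseteq> carrier M"
  shows "submodule (submodule_generated K M S) K M" "S \<subseteq> submodule_generated K M S"
proof -
  interpret module K M by fact
  have *: "H \<subseteq> carrier M" "\<zero>\<^bsub>M\<^esub> \<in> H" if "submodule H K M" for H
    using that submoduleE[OF that] subgroup.one_closed[OF submodule.axioms(1)[OF that]] by auto
  show "S \<subseteq> submodule_generated K M S" by (auto simp: submodule_generated_def)
  show "submodule (submodule_generated K M S) K M"
  proof (rule submoduleI)
    show "submodule_generated K M S \<subseteq> carrier M"
      using carrier_is_submodule assms(2) by (auto simp: submodule_generated_def)
  qed (auto simp: submodule_generated_def * submoduleE)
qed

lemma submodule_generated_least: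
  "submodule H K M \<Longrightarrow> S \<subseteq> H \<Longrightarrow> submodule_generated K M S \<subseteq> H"
  by (auto simp: submodule_generated_def)

lemma quotient_module_facts:
  assumes "module K M" "submodule H K M"
  shows "module K (quotient_module M H)"
    and "\<And>X. X \<in> carrier (quotient_module M H) \<longleftrightarrow> (\<exists>x\<in>carrier M. X = H +>\<^bsub>M\<^esub> x)"
    and "\<And>x y. x \<in> carrier M \<Longrightarrow> y \<in> carrier M \<Longrightarrow>
      (H +>\<^bsub>M\<^esub> x) \<oplus>\<^bsub>quotient_module M H\<^esub> (H +>\<^bsub>M\<^esub> y) = H +>\<^bsub>M\<^esub> (x \<oplus>\<^bsub>M\<^esub> y)"
    and "\<And>a x. a \<in> carrier K \<Longrightarrow> x \<in> carrier M \<Longrightarrow>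
      a \<odot>\<^bsub>quotient_module M H\<^esub> (H +>\<^bsub>M\<^esub> x) = H +>\<^bsub>M\<^esub> (a \<odot>\<^bsub>M\<^esub> x)"
    and "\<And>x y. x \<in> carrier M \<Longrightarrow> y \<in> carrier M \<Longrightarrow>
      H +>\<^bsub>M\<^esub> x = H +>\<^bsub>M\<^esub> y \<longleftrightarrow> x \<ominus>\<^bsub>M\<^esub> y \<in> H"
    and "\<And>x. x \<in> carrier M \<Longrightarrow> x \<in> H +>\<^bsub>M\<^esub> x"
proof -
  interpret module K M by fact
  interpret sub: submodule H K M by fact
  interpret H: abelian_subgroup H M
    by (rule abelian_subgroupI3)
      (auto intro!: additive_subgroup.intro sub.subgroup_axioms M.abelian_group_axioms)
  let ?Q = "quotient_module M H"
  show car: "\<And>X. X \<in> carrier (quotient_module M H) \<longleftrightarrow> (\<exists>x\<in>carrier M. X = H +>\<^bsub>M\<^esub> x)"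
    by (auto simp: quotient_module_def A_RCOSETS_def')
  show add: "(H +>\<^bsub>M\<^esub> x) \<oplus>\<^bsub>quotient_module M H\<^esub> (H +>\<^bsub>M\<^esub> y) = H +>\<^bsub>M\<^esub> (x \<oplus>\<^bsub>M\<^esub> y)"
    if "x \<in> carrier M" "y \<in> carrier M" for x y
    using H.a_rcos_sum[OF that] by (simp add: quotient_module_def)
  show self: "\<And>x. x \<in> carrier M \<Longrightarrow> x \<in> H +>\<^bsub>M\<^esub> x" by (rule H.a_rcos_self)
  show eq: "H +>\<^bsub>M\<^esub> x = H +>\<^bsub>M\<^esub> y \<longleftrightarrow> x \<ominus>\<^bsub>M\<^esub> y \<in> H"
    if "x \<in> carrier M" "y \<in> carrier M" for x y
  proof
    assume "H +>\<^bsub>M\<^esub> x = H +>\<^bsub>M\<^esub> y"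
    then have "x \<in> H +>\<^bsub>M\<^esub> y" using self that by blast
    then obtain h where h: "h \<in> H" "x = h \<oplus>\<^bsub>M\<^esub> y" by (auto simp: a_r_coset_def')
    then have "x \<ominus>\<^bsub>M\<^esub> y = h" using that sub.mem_carrier
      by (simp add: M.minus_eq M.a_assoc M.r_neg)
    then show "x \<ominus>\<^bsub>M\<^esub> y \<in> H" using h by simp
  next
    assume h: "x \<ominus>\<^bsub>M\<^esub> y \<in> H"
    have "x = (x \<ominus>\<^bsub>M\<^esub> y) \<oplus>\<^bsub>M\<^esub> y" using that by (simp add: M.minus_eq M.a_assoc M.l_neg)
    then have "x \<in> H +>\<^bsub>M\<^esub> y" using h by (auto simp: a_r_coset_def')
    then show "H +>\<^bsub>M\<^esub> x = H +>\<^bsub>M\<^esub> y"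
      using M.a_repr_independence'[of x H y] that H.a_subgroup by (simp add: a_r_coset_def)
  qed
  have ominus: "a \<odot>\<^bsub>M\<^esub> x \<ominus>\<^bsub>M\<^esub> a \<odot>\<^bsub>M\<^esub> y = a \<odot>\<^bsub>M\<^esub> (x \<ominus>\<^bsub>M\<^esub> y)"
    if "a \<in> carrier K" "x \<in> carrier M" "y \<in> carrier M" for a x y
    using that by (simp add: M.minus_eq smult_r_distr smult_r_minus)
  show smult: "a \<odot>\<^bsub>quotient_module M H\<^esub> (H +>\<^bsub>M\<^esub> x) = H +>\<^bsub>M\<^esub> (a \<odot>\<^bsub>M\<^esub> x)"
    if a: "a \<in> carrier K" and x: "x \<in> carrier M" for a x
  proof -
    have const: "H +>\<^bsub>M\<^esub> (a \<odot>\<^bsub>M\<^esub> y) = H +>\<^bsub>M\<^esub> (a \<odot>\<^bsub>M\<^esub> x)" if y: "y \<in> H +>\<^bsub>M\<^esub> x" for y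
    proof -
      obtain h where h: "h \<in> H" "y = h \<oplus>\<^bsub>M\<^esub> x" using y by (auto simp: a_r_coset_def')
      then have yc: "y \<in> carrier M" using x sub.mem_carrier by simp
      have "y \<ominus>\<^bsub>M\<^esub> x = h" using h x sub.mem_carrier
        by (simp add: M.minus_eq M.a_assoc M.r_neg)
      then have "a \<odot>\<^bsub>M\<^esub> y \<ominus>\<^bsub>M\<^esub> a \<odot>\<^bsub>M\<^esub> x \<in> H" using ominus[OF a yc x] h a by simp
      then show ?thesis using eq a x yc by simp
    qed
    have "(\<Union>y\<in>H +>\<^bsub>M\<^esub> x. H +>\<^bsub>M\<^esub> (a \<odot>\<^bsub>M\<^esub> y)) = (\<Union>y\<in>H +>\<^bsub>M\<^esub> x. H +>\<^bsub>M\<^esub> (a \<odot>\<^bsub>M\<^esub> x))"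
      using const by (rule SUP_cong[OF refl])
    also have "\<dots> = H +>\<^bsub>M\<^esub> (a \<odot>\<^bsub>M\<^esub> x)" using self[OF x] by blast
    finally show ?thesis by (simp add: quotient_module_def)
  qed
  show "module K ?Q"
  proof (rule moduleI)
    show "cring K" by (rule R.is_cring)
    have zero: "\<zero>\<^bsub>?Q\<^esub> = H +>\<^bsub>M\<^esub> \<zero>\<^bsub>M\<^esub>"
      using sub.mem_carrier by (auto simp: quotient_module_def a_r_coset_def')
    show "abelian_group ?Q"
    proof (rule abelian_groupI)
      fix x y z assume "x \<in> carrier ?Q" "y \<in> carrier ?Q" "z \<in> carrier ?Q"
      moreover from this obtain u v w where "u \<in> carrier M" "x = H +>\<^bsub>M\<^esub> u"
        "v \<in> carrier M" "y = H +>\<^bsub>M\<^esub> v" "w \<in> carrier M" "z = H +>\<^bsub>M\<^esub> w" by (auto simp: car)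
      ultimately show "x \<oplus>\<^bsub>?Q\<^esub> y \<oplus>\<^bsub>?Q\<^esub> z = x \<oplus>\<^bsub>?Q\<^esub> (y \<oplus>\<^bsub>?Q\<^esub> z)"
        by (simp add: add M.a_assoc)
    next
      fix x y assume "x \<in> carrier ?Q" "y \<in> carrier ?Q"
      moreover from this obtain u v where uv: "u \<in> carrier M" "x = H +>\<^bsub>M\<^esub> u"
        "v \<in> carrier M" "y = H +>\<^bsub>M\<^esub> v" by (auto simp: car)
      ultimately show "x \<oplus>\<^bsub>?Q\<^esub> y = y \<oplus>\<^bsub>?Q\<^esub> x" by (simp add: add M.a_comm)
      have "u \<oplus>\<^bsub>M\<^esub> v \<in> carrier M" using uv by simp
      then show "x \<oplus>\<^bsub>?Q\<^esub> y \<in> carrier ?Q" unfolding car using uv add by blast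
    next
      show "\<zero>\<^bsub>?Q\<^esub> \<in> carrier ?Q" using zero unfolding car by blast
    next
      fix x assume "x \<in> carrier ?Q"
      then obtain u where u: "u \<in> carrier M" "x = H +>\<^bsub>M\<^esub> u" by (auto simp: car)
      then show "\<zero>\<^bsub>?Q\<^esub> \<oplus>\<^bsub>?Q\<^esub> x = x" by (simp add: zero add)
      have "(H +>\<^bsub>M\<^esub> (\<ominus>\<^bsub>M\<^esub> u)) \<oplus>\<^bsub>?Q\<^esub> x = \<zero>\<^bsub>?Q\<^esub>" using u by (simp add: zero add M.l_neg)
      moreover have "H +>\<^bsub>M\<^esub> (\<ominus>\<^bsub>M\<^esub> u) \<in> carrier ?Q" unfolding car using u M.a_inv_closed by blast
      ultimately show "\<exists>y\<in>carrier ?Q. y \<oplus>\<^bsub>?Q\<^esub> x = \<zero>\<^bsub>?Q\<^esub>" by blast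
    qed
  next
    fix a x assume "a \<in> carrier K" "x \<in> carrier ?Q"
    then show "a \<odot>\<^bsub>?Q\<^esub> x \<in> carrier ?Q" using smult by (auto simp: car)
  next
    fix a b x assume "a \<in> carrier K" "b \<in> carrier K" "x \<in> carrier ?Q"
    moreover from this obtain u where "u \<in> carrier M" "x = H +>\<^bsub>M\<^esub> u" by (auto simp: car)
    ultimately show "(a \<oplus>\<^bsub>K\<^esub> b) \<odot>\<^bsub>?Q\<^esub> x = a \<odot>\<^bsub>?Q\<^esub> x \<oplus>\<^bsub>?Q\<^esub> b \<odot>\<^bsub>?Q\<^esub> x"
      and "(a \<otimes>\<^bsub>K\<^esub> b) \<odot>\<^bsub>?Q\<^esub> x = a \<odot>\<^bsub>?Q\<^esub> (b \<odot>\<^bsub>?Q\<^esub> x)"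
      by (simp_all add: add smult smult_l_distr smult_assoc1)
  next
    fix a x y assume "a \<in> carrier K" "x \<in> carrier ?Q" "y \<in> carrier ?Q"
    moreover from this obtain u v where "u \<in> carrier M" "x = H +>\<^bsub>M\<^esub> u"
      "v \<in> carrier M" "y = H +>\<^bsub>M\<^esub> v" by (auto simp: car)
    ultimately show "a \<odot>\<^bsub>?Q\<^esub> (x \<oplus>\<^bsub>?Q\<^esub> y) = a \<odot>\<^bsub>?Q\<^esub> x \<oplus>\<^bsub>?Q\<^esub> a \<odot>\<^bsub>?Q\<^esub> y"
      by (simp add: add smult smult_r_distr)
  next
    fix x assume "x \<in> carrier ?Q"
    then obtain u where "u \<in> carrier M" "x = H +>\<^bsub>M\<^esub> u" by (auto simp: car)
    then show "\<one>\<^bsub>K\<^esub> \<odot>\<^bsub>?Q\<^esub> x = x" by (simp add: smult)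
  qed
qed

locale tensor_pair = M: module K M + N: module K N
  for K :: "('k, 'r) ring_scheme" and M :: "('k, 'a, 'm) module_scheme"
    and N :: "('k, 'b, 'n) module_scheme"
begin

abbreviation "F \<equiv> free_module K (carrier M \<times> carrier N)"
abbreviation "T \<equiv> tensor_product K M N"
abbreviation "H \<equiv> tensor_null K M N"
abbreviation "e \<equiv> free_gen K"
abbreviation pt (infixl "\<otimes>\<^sub>T" 70) where "x \<otimes>\<^sub>T y \<equiv> pure_tensor K M N x y"

sublocale F: module K F by (rule free_module_module) (rule M.R.is_cring)

lemma e_closed [simp]: "x \<in> carrier M \<Longrightarrow> y \<in> carrier N \<Longrightarrow> e (x, y) \<in> carrier F"
  by (rule free_gen_closed[OF M.R.is_cring]) auto

lemma rel_sub: "tensor_relations K M N \<subseteq> carrier F"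
  by (auto simp: tensor_relations_def Let_def)

lemma sub: "submodule H K F" "tensor_relations K M N \<subseteq> H"
  unfolding tensor_null_def
  by (rule submodule_generated_submodule[OF F.module_axioms rel_sub])+

lemmas quot = quotient_module_facts[OF F.module_axioms sub(1), folded tensor_product_def]

lemma tensor_module: "module K T" by (rule quot(1))

sublocale T: module K T by (rule tensor_module)

lemma pure_closed [simp]: "x \<in> carrier M \<Longrightarrow> y \<in> carrier N \<Longrightarrow> x \<otimes>\<^sub>T y \<in> carrier T"
  by (auto simp: quot(2) pure_tensor_def)

lemma pure_bilinear: "pure_tensor K M N \<in> bilinear_maps K M N T"
proof -
  have 1: "(x \<oplus>\<^bsub>M\<^esub> x') \<otimes>\<^sub>T y = x \<otimes>\<^sub>T y \<oplus>\<^bsub>T\<^esub> x' \<otimes>\<^sub>T y"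
    if "x \<in> carrier M" "x' \<in> carrier M" "y \<in> carrier N" for x x' y
  proof -
    have "e (x \<oplus>\<^bsub>M\<^esub> x', y) \<ominus>\<^bsub>F\<^esub> (e (x, y) \<oplus>\<^bsub>F\<^esub> e (x', y)) \<in> H"
      using that by (intro subsetD[OF sub(2)]) (auto simp: tensor_relations_def Let_def)
    then show ?thesis using that by (simp add: pure_tensor_def quot(3,5))
  qed
  have 2: "x \<otimes>\<^sub>T (y \<oplus>\<^bsub>N\<^esub> y') = x \<otimes>\<^sub>T y \<oplus>\<^bsub>T\<^esub> x \<otimes>\<^sub>T y'"
    if "x \<in> carrier M" "y \<in> carrier N" "y' \<in> carrier N" for x y y'
  proof -
    have "e (x, y \<oplus>\<^bsub>N\<^esub> y') \<ominus>\<^bsub>F\<^esub> (e (x, y) \<oplus>\<^bsub>F\<^esub> e (x, y')) \<in> H"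
      using that by (intro subsetD[OF sub(2)]) (auto simp: tensor_relations_def Let_def)
    then show ?thesis using that by (simp add: pure_tensor_def quot(3,5))
  qed
  have 3: "(a \<odot>\<^bsub>M\<^esub> x) \<otimes>\<^sub>T y = a \<odot>\<^bsub>T\<^esub> (x \<otimes>\<^sub>T y)"
    if "x \<in> carrier M" "a \<in> carrier K" "y \<in> carrier N" for a x y
  proof -
    have "e (a \<odot>\<^bsub>M\<^esub> x, y) \<ominus>\<^bsub>F\<^esub> (a \<odot>\<^bsub>F\<^esub> e (x, y)) \<in> H"
      using that by (intro subsetD[OF sub(2)]) (auto simp: tensor_relations_def Let_def)
    then show ?thesis using that by (simp add: pure_tensor_def quot(4,5))
  qed
  have 4: "x \<otimes>\<^sub>T (a \<odot>\<^bsub>N\<^esub> y) = a \<odot>\<^bsub>T\<^esub> (x \<otimes>\<^sub>T y)"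
    if "x \<in> carrier M" "a \<in> carrier K" "y \<in> carrier N" for a x y
  proof -
    have "e (x, a \<odot>\<^bsub>N\<^esub> y) \<ominus>\<^bsub>F\<^esub> (a \<odot>\<^bsub>F\<^esub> e (x, y)) \<in> H"
      using that by (intro subsetD[OF sub(2)]) (auto simp: tensor_relations_def Let_def)
    then show ?thesis using that by (simp add: pure_tensor_def quot(4,5))
  qed
  show ?thesis by (auto simp: bilinear_maps_def lin_maps_def 1 2 3 4)
qed

lemma free_induct [consumes 1, case_names zero step]:
  assumes u: "u \<in> carrier F" and z: "Q \<zero>\<^bsub>F\<^esub>"
    and st: "\<And>v a x y. v \<in> carrier F \<Longrightarrow> Q v \<Longrightarrow> a \<in> carrier K \<Longrightarrow> x \<in> carrier M \<Longrightarrow> y \<in> carrier N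
      \<Longrightarrow> Q (v \<oplus>\<^bsub>F\<^esub> a \<odot>\<^bsub>F\<^esub> e (x, y))"
  shows "Q u"
proof -
  have "finite {p. u p \<noteq> \<zero>\<^bsub>K\<^esub>}" using u by (simp add: free_module_def)
  then show ?thesis using u
  proof (induction "{p. u p \<noteq> \<zero>\<^bsub>K\<^esub>}" arbitrary: u rule: finite_psubset_induct)
    case (psubset u)
    show ?case
    proof (cases "\<exists>p. u p \<noteq> \<zero>\<^bsub>K\<^esub>")
      case False
      then have "u = \<zero>\<^bsub>F\<^esub>" by (auto simp: free_module_def)
      then show ?thesis using z by simp
    next
      case True
      then obtain p where p: "u p \<noteq> \<zero>\<^bsub>K\<^esub>" by blast
      obtain x y where xy: "p = (x, y)" by force
      have m: "x \<in> carrier M" "y \<in> carrier N" using p psubset.prems xy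
        by (auto simp: free_module_def)
      define v where "v = u(p := \<zero>\<^bsub>K\<^esub>)"
      have ps: "{q. v q \<noteq> \<zero>\<^bsub>K\<^esub>} \<subset> {q. u q \<noteq> \<zero>\<^bsub>K\<^esub>}" using p by (auto simp: v_def)
      have vF: "v \<in> carrier F" using psubset.prems finite_subset[OF psubset_imp_subset[OF ps]]
        by (auto simp: free_module_def v_def)
      have "Q v" by (rule psubset.hyps(2)[OF ps vF])
      moreover have "u p \<in> carrier K" using psubset.prems
        by (simp add: free_module_def del: mem_Times_iff split_paired_All)
      ultimately have "Q (v \<oplus>\<^bsub>F\<^esub> u p \<odot>\<^bsub>F\<^esub> e (x, y))" using st vF m by blast
      moreover have "v \<oplus>\<^bsub>F\<^esub> u p \<odot>\<^bsub>F\<^esub> e (x, y) = u"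
        using psubset.prems by (auto simp: free_module_def free_gen_def v_def xy fun_eq_iff)
      ultimately show ?thesis by simp
    qed
  qed
qed

lemma tensor_induct [consumes 1, case_names zero step]:
  assumes t: "t \<in> carrier T" and z: "Q \<zero>\<^bsub>T\<^esub>"
    and st: "\<And>v a x y. v \<in> carrier T \<Longrightarrow> Q v \<Longrightarrow> a \<in> carrier K \<Longrightarrow> x \<in> carrier M \<Longrightarrow> y \<in> carrier N
      \<Longrightarrow> Q (v \<oplus>\<^bsub>T\<^esub> a \<odot>\<^bsub>T\<^esub> (x \<otimes>\<^sub>T y))"
  shows "Q t"
proof -
  obtain u where u: "u \<in> carrier F" "t = H +>\<^bsub>F\<^esub> u" using t by (auto simp: quot(2))
  have z': "H +>\<^bsub>F\<^esub> \<zero>\<^bsub>F\<^esub> = \<zero>\<^bsub>T\<^esub>"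
    using quot(4)[of "\<zero>\<^bsub>K\<^esub>" "\<zero>\<^bsub>F\<^esub>"] quot(2) by (metis F.smult_l_null F.M.zero_closed M.R.zero_closed T.smult_l_null)
  have "Q (H +>\<^bsub>F\<^esub> u)" using u(1)
  proof (induction rule: free_induct)
    case zero then show ?case using z z' by simp
  next
    case (step v a x y)
    then have "Q ((H +>\<^bsub>F\<^esub> v) \<oplus>\<^bsub>T\<^esub> a \<odot>\<^bsub>T\<^esub> (x \<otimes>\<^sub>T y))" by (intro st) (auto simp: quot(2))
    then show ?case using step by (simp add: pure_tensor_def quot(3,4))
  qed
  then show ?thesis using u by simp
qed

lemma lin_zero: "\<And>f L. module K L \<Longrightarrow> f \<in> lin_maps K T L \<Longrightarrow> f \<zero>\<^bsub>T\<^esub> = \<zero>\<^bsub>L\<^esub>"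
proof -
  fix f and L :: "('k,'x,'y) module_scheme" assume "module K L" and f: "f \<in> lin_maps K T L"
  then interpret L: module K L by simp
  have "f (\<zero>\<^bsub>K\<^esub> \<odot>\<^bsub>T\<^esub> \<zero>\<^bsub>T\<^esub>) = \<zero>\<^bsub>K\<^esub> \<odot>\<^bsub>L\<^esub> f \<zero>\<^bsub>T\<^esub>"
    using f M.R.zero_closed T.zero_closed unfolding lin_maps_def by blast
  then show "f \<zero>\<^bsub>T\<^esub> = \<zero>\<^bsub>L\<^esub>" using f by (auto simp: lin_maps_def Pi_iff)
qed

lemma tensor_ext:
  assumes "module K L" "f \<in> lin_maps K T L" "g \<in> lin_maps K T L"
    and "\<And>x y. x \<in> carrier M \<Longrightarrow> y \<in> carrier N \<Longrightarrow> f (x \<otimes>\<^sub>T y) = g (x \<otimes>\<^sub>T y)"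
    and "t \<in> carrier T"
  shows "f t = g t"
  using assms(5)
proof (induction rule: tensor_induct)
  case zero then show ?case using lin_zero[OF assms(1,2)] lin_zero[OF assms(1,3)] by simp
next
  case (step v a x y)
  then show ?case using assms(2,3,4) by (auto simp: lin_maps_def)
qed

lemma ex_tensor_lift:
  assumes L: "module K L" and b: "\<beta> \<in> bilinear_maps K M N L"
  shows "\<exists>h \<in> lin_maps K T L. \<forall>x\<in>carrier M. \<forall>y\<in>carrier N. h (x \<otimes>\<^sub>T y) = \<beta> x y"
proof -
  interpret L: module K L by fact
  have bc [simp]: "x \<in> carrier M \<Longrightarrow> y \<in> carrier N \<Longrightarrow> \<beta> x y \<in> carrier L" for x y
    using b by (auto simp: bilinear_maps_def lin_maps_def)
  define \<phi> where "\<phi> u = (\<Oplus>\<^bsub>L\<^esub>p\<in>{p. u p \<noteq> \<zero>\<^bsub>K\<^esub>}. u p \<odot>\<^bsub>L\<^esub> \<beta> (fst p) (snd p))" for u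
  have FD: "u p \<in> carrier K" "p \<notin> carrier M \<times> carrier N \<Longrightarrow> u p = \<zero>\<^bsub>K\<^esub>" "finite {p. u p \<noteq> \<zero>\<^bsub>K\<^esub>}"
    if "u \<in> carrier F" for u p using that unfolding free_module_def partial_object.simps mem_Collect_eq by blast+
  have \<phi>_on: "\<phi> u = (\<Oplus>\<^bsub>L\<^esub>p\<in>A. u p \<odot>\<^bsub>L\<^esub> \<beta> (fst p) (snd p))"
    if "u \<in> carrier F" "finite A" "{p. u p \<noteq> \<zero>\<^bsub>K\<^esub>} \<subseteq> A" "A \<subseteq> carrier M \<times> carrier N" for u A
    unfolding \<phi>_def
  proof (rule L.add.finprod_mono_neutral_cong_left[OF that(2,3)])
    have c: "\<beta> (fst p) (snd p) \<in> carrier L" if "p \<in> A" for p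
      using \<open>A \<subseteq> carrier M \<times> carrier N\<close> that by (intro bc) auto
    show "u p \<odot>\<^bsub>L\<^esub> \<beta> (fst p) (snd p) = \<zero>\<^bsub>L\<^esub>" if "p \<in> A - {p. u p \<noteq> \<zero>\<^bsub>K\<^esub>}" for p
      using that c by simp
    show "(\<lambda>p. u p \<odot>\<^bsub>L\<^esub> \<beta> (fst p) (snd p)) \<in> A \<rightarrow> carrier L"
      using c FD(1)[OF \<open>u \<in> carrier F\<close>] by simp
  qed simp
  have term_c: "u p \<odot>\<^bsub>L\<^esub> \<beta> (fst p) (snd p) \<in> carrier L" if "u \<in> carrier F" "p \<in> carrier M \<times> carrier N" for u p
    using that(2) FD(1)[OF that(1)] by auto
  have supp: "{p. u p \<noteq> \<zero>\<^bsub>K\<^esub>} \<subseteq> carrier M \<times> carrier N" if "u \<in> carrier F" for u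
    using FD[OF that] by blast
  have \<phi>c: "\<phi> u \<in> carrier L" if "u \<in> carrier F" for u
    unfolding \<phi>_def using supp[OF that] term_c[OF that] by (intro L.M.finsum_closed) blast
  have \<phi>add: "\<phi> (u \<oplus>\<^bsub>F\<^esub> v) = \<phi> u \<oplus>\<^bsub>L\<^esub> \<phi> v" if u: "u \<in> carrier F" and v: "v \<in> carrier F" for u v
  proof -
    define A where "A = {p. u p \<noteq> \<zero>\<^bsub>K\<^esub>} \<union> {p. v p \<noteq> \<zero>\<^bsub>K\<^esub>}"
    have A: "finite A" "A \<subseteq> carrier M \<times> carrier N" using FD(3) supp u v by (auto simp: A_def)
    have bA: "\<And>p. p \<in> A \<Longrightarrow> \<beta> (fst p) (snd p) \<in> carrier L" using A(2) by (intro bc) auto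
    have ev: "(u \<oplus>\<^bsub>F\<^esub> v) p = u p \<oplus>\<^bsub>K\<^esub> v p" for p by (simp add: free_module_def)
    have "{p. (u \<oplus>\<^bsub>F\<^esub> v) p \<noteq> \<zero>\<^bsub>K\<^esub>} \<subseteq> A" by (auto simp: ev A_def)
    then have "\<phi> (u \<oplus>\<^bsub>F\<^esub> v) = (\<Oplus>\<^bsub>L\<^esub>p\<in>A. (u p \<oplus>\<^bsub>K\<^esub> v p) \<odot>\<^bsub>L\<^esub> \<beta> (fst p) (snd p))"
      using \<phi>_on[of "u \<oplus>\<^bsub>F\<^esub> v" A] u v A by (simp add: ev)
    also have "\<dots> = (\<Oplus>\<^bsub>L\<^esub>p\<in>A. u p \<odot>\<^bsub>L\<^esub> \<beta> (fst p) (snd p) \<oplus>\<^bsub>L\<^esub> v p \<odot>\<^bsub>L\<^esub> \<beta> (fst p) (snd p))"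
      using bA FD(1) u v by (intro L.M.finsum_cong') (simp_all add: L.smult_l_distr)
    also have "\<dots> = \<phi> u \<oplus>\<^bsub>L\<^esub> \<phi> v"
      using \<phi>_on[OF u A(1) _ A(2)] \<phi>_on[OF v A(1) _ A(2)] bA FD(1) u v
      by (subst L.M.finsum_addf) (simp_all add: A_def)
    finally show ?thesis .
  qed
  have \<phi>smult: "\<phi> (a \<odot>\<^bsub>F\<^esub> u) = a \<odot>\<^bsub>L\<^esub> \<phi> u" if u: "u \<in> carrier F" and a: "a \<in> carrier K" for u a
  proof -
    define A where "A = {p. u p \<noteq> \<zero>\<^bsub>K\<^esub>}"
    have A: "finite A" "A \<subseteq> carrier M \<times> carrier N" using FD(3) supp u by (auto simp: A_def)
    have bA: "\<And>p. p \<in> A \<Longrightarrow> \<beta> (fst p) (snd p) \<in> carrier L" using A(2) by (intro bc) auto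
    have ev: "(a \<odot>\<^bsub>F\<^esub> u) p = a \<otimes>\<^bsub>K\<^esub> u p" for p by (simp add: free_module_def)
    have "{p. (a \<odot>\<^bsub>F\<^esub> u) p \<noteq> \<zero>\<^bsub>K\<^esub>} \<subseteq> A" using a by (auto simp: ev A_def)
    then have "\<phi> (a \<odot>\<^bsub>F\<^esub> u) = (\<Oplus>\<^bsub>L\<^esub>p\<in>A. (a \<otimes>\<^bsub>K\<^esub> u p) \<odot>\<^bsub>L\<^esub> \<beta> (fst p) (snd p))"
      using \<phi>_on[of "a \<odot>\<^bsub>F\<^esub> u" A] u a A by (simp add: ev)
    also have "\<dots> = (\<Oplus>\<^bsub>L\<^esub>p\<in>A. a \<odot>\<^bsub>L\<^esub> (u p \<odot>\<^bsub>L\<^esub> \<beta> (fst p) (snd p)))"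
      using bA FD(1) u a by (intro L.M.finsum_cong') (simp_all add: L.smult_assoc1)
    also have "\<dots> = a \<odot>\<^bsub>L\<^esub> \<phi> u"
      using A(1) \<phi>_on[OF u A(1) _ A(2)] bA FD(1) u a
      by (subst L.finsum_smult_ldistr[symmetric]) (simp_all add: A_def)
    finally show ?thesis .
  qed
  have \<phi>e: "\<phi> (e (x, y)) = \<beta> x y" if "x \<in> carrier M" "y \<in> carrier N" for x y
  proof -
    have "\<phi> (e (x, y)) = (\<Oplus>\<^bsub>L\<^esub>p\<in>{(x, y)}. e (x, y) p \<odot>\<^bsub>L\<^esub> \<beta> (fst p) (snd p))"
      using that e_closed[OF that] by (intro \<phi>_on) (auto simp: free_gen_def)
    then show ?thesis using that by (simp add: free_gen_def)
  qed
  have \<phi>0: "\<phi> \<zero>\<^bsub>F\<^esub> = \<zero>\<^bsub>L\<^esub>" by (simp add: \<phi>_def free_module_def)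
  have \<phi>minus: "\<phi> (u \<ominus>\<^bsub>F\<^esub> v) = \<phi> u \<ominus>\<^bsub>L\<^esub> \<phi> v" if "u \<in> carrier F" "v \<in> carrier F" for u v
  proof -
    have "\<phi> (u \<ominus>\<^bsub>F\<^esub> v) \<oplus>\<^bsub>L\<^esub> \<phi> v = \<phi> (u \<ominus>\<^bsub>F\<^esub> v \<oplus>\<^bsub>F\<^esub> v)" using that by (simp add: \<phi>add)
    also have "u \<ominus>\<^bsub>F\<^esub> v \<oplus>\<^bsub>F\<^esub> v = u" using that by (simp add: F.M.minus_eq F.M.a_assoc F.M.l_neg)
    finally have *: "\<phi> (u \<ominus>\<^bsub>F\<^esub> v) \<oplus>\<^bsub>L\<^esub> \<phi> v = \<phi> u" .
    show ?thesis using that by (simp add: *[symmetric] \<phi>c L.M.minus_eq L.M.a_assoc L.M.r_neg)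
  qed
  have self0: "z \<ominus>\<^bsub>L\<^esub> z = \<zero>\<^bsub>L\<^esub>" if "z \<in> carrier L" for z using that by (simp add: L.M.minus_eq L.M.r_neg)
  have canc: "w = z" if "w \<in> carrier L" "z \<in> carrier L" "w \<ominus>\<^bsub>L\<^esub> z = \<zero>\<^bsub>L\<^esub>" for w z
  proof -
    have "w = (w \<ominus>\<^bsub>L\<^esub> z) \<oplus>\<^bsub>L\<^esub> z" using that(1,2) by (simp add: L.M.minus_eq L.M.a_assoc L.M.l_neg)
    then show ?thesis using that by simp
  qed
  let ?ker = "{u \<in> carrier F. \<phi> u = \<zero>\<^bsub>L\<^esub>}"
  have "submodule ?ker K F"
  proof (rule F.submoduleI)
    fix u assume "u \<in> ?ker"
    then show "\<ominus>\<^bsub>F\<^esub> u \<in> ?ker" using \<phi>minus[of "\<zero>\<^bsub>F\<^esub>" u] by (simp add: \<phi>0 F.M.minus_eq L.M.minus_eq)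
  qed (auto simp: \<phi>0 \<phi>add \<phi>smult)
  moreover have "tensor_relations K M N \<subseteq> ?ker"
    using b by (auto simp: tensor_relations_def Let_def \<phi>minus \<phi>add \<phi>smult \<phi>e self0 bilinear_maps_def lin_maps_def)
  ultimately have ker: "H \<subseteq> ?ker" unfolding tensor_null_def by (rule submodule_generated_least)
  define h where "h X = \<phi> (SOME u. u \<in> carrier F \<and> X = H +>\<^bsub>F\<^esub> u)" for X
  have h: "h (H +>\<^bsub>F\<^esub> u) = \<phi> u" if "u \<in> carrier F" for u
  proof -
    let ?v = "SOME v. v \<in> carrier F \<and> H +>\<^bsub>F\<^esub> u = H +>\<^bsub>F\<^esub> v"
    have v: "?v \<in> carrier F \<and> H +>\<^bsub>F\<^esub> u = H +>\<^bsub>F\<^esub> ?v" by (rule someI[of _ u]) (use that in auto)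
    then have "u \<ominus>\<^bsub>F\<^esub> ?v \<in> H" using that quot(5) by blast
    then have "\<phi> u \<ominus>\<^bsub>L\<^esub> \<phi> ?v = \<zero>\<^bsub>L\<^esub>" using ker \<phi>minus that v by auto
    then have "\<phi> u = \<phi> ?v" using canc[OF \<phi>c \<phi>c] that v by blast
    then show ?thesis by (simp add: h_def)
  qed
  have "h \<in> lin_maps K T L"
    by (auto simp: lin_maps_def quot(2) quot(3,4) h \<phi>c \<phi>add \<phi>smult)
  moreover have "\<forall>x\<in>carrier M. \<forall>y\<in>carrier N. h (x \<otimes>\<^sub>T y) = \<beta> x y"
    by (simp add: pure_tensor_def h \<phi>e)
  ultimately show ?thesis by blast
qed

lemma ex1_tensor_lift:
  assumes L: "module K L" and b: "\<beta> \<in> bilinear_maps K M N L"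
  shows "\<exists>!h. h \<in> lin_maps K T L \<and> h \<in> extensional (carrier T) \<and>
    (\<forall>x\<in>carrier M. \<forall>y\<in>carrier N. h (x \<otimes>\<^sub>T y) = \<beta> x y)"
proof -
  obtain h where h: "h \<in> lin_maps K T L" "\<forall>x\<in>carrier M. \<forall>y\<in>carrier N. h (x \<otimes>\<^sub>T y) = \<beta> x y"
    using ex_tensor_lift[OF assms] by blast
  have "restrict h (carrier T) \<in> lin_maps K T L" using h(1) by (auto simp: lin_maps_def)
  moreover have "h' = restrict h (carrier T)"
    if h': "h' \<in> lin_maps K T L" "h' \<in> extensional (carrier T)"
      "\<forall>x\<in>carrier M. \<forall>y\<in>carrier N. h' (x \<otimes>\<^sub>T y) = \<beta> x y" for h'
  proof (rule extensionalityI[of _ "carrier T"])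
    fix t assume t: "t \<in> carrier T"
    have "h' t = h t" by (rule tensor_ext[OF L h'(1) h(1) _ t]) (use h' h in simp)
    then show "h' t = restrict h (carrier T) t" using t by simp
  qed (use h' in auto)
  moreover have "\<forall>x\<in>carrier M. \<forall>y\<in>carrier N. restrict h (carrier T) (x \<otimes>\<^sub>T y) = \<beta> x y"
    using h(2) by simp
  moreover have "restrict h (carrier T) \<in> extensional (carrier T)" by simp
  ultimately show ?thesis by blast
qed

lemma tensor_lift:
  assumes "module K L" "\<beta> \<in> bilinear_maps K M N L"
  shows "tensor_lift K M N L \<beta> \<in> lin_maps K T L"
    and "x \<in> carrier M \<Longrightarrow> y \<in> carrier N \<Longrightarrow> tensor_lift K M N L \<beta> (x \<otimes>\<^sub>T y) = \<beta> x y"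
  using theI'[OF ex1_tensor_lift[OF assms]] unfolding tensor_lift_def by blast+

end

definition tensor_map ::
    "('k, 'r) ring_scheme \<Rightarrow> ('k, 'a, 'm) module_scheme \<Rightarrow> ('k, 'b, 'n) module_scheme
      \<Rightarrow> ('k, 'c, 'l) module_scheme \<Rightarrow> ('k, 'd, 'o) module_scheme
      \<Rightarrow> ('a \<Rightarrow> 'c) \<Rightarrow> ('b \<Rightarrow> 'd) \<Rightarrow> ('k, 'a, 'b) tensor \<Rightarrow> ('k, 'c, 'd) tensor"
  where "tensor_map K M N M' N' f g =
    tensor_lift K M N (tensor_product K M' N') (\<lambda>x y. pure_tensor K M' N' (f x) (g y))"

definition tensor_assoc ::
    "('k, 'r) ring_scheme \<Rightarrow> ('k, 'a, 'm) module_scheme \<Rightarrow> ('k, 'b, 'n) module_scheme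
      \<Rightarrow> ('k, 'c, 'l) module_scheme
      \<Rightarrow> ('k, ('k, 'a, 'b) tensor, 'c) tensor \<Rightarrow> ('k, 'a, ('k, 'b, 'c) tensor) tensor"
  where "tensor_assoc K L M N =
    tensor_lift K (tensor_product K L M) N (tensor_product K L (tensor_product K M N))
      (\<lambda>t z. tensor_lift K L M (tensor_product K L (tensor_product K M N))
        (\<lambda>x y. pure_tensor K L (tensor_product K M N) x (pure_tensor K M N y z)) t)"

locale coalgebra = K?: field K + C?: module K C
  for K :: "('k, 'r) ring_scheme" and C :: "('k, 'c, 'm) module_scheme"
  and \<Delta> :: "'c \<Rightarrow> ('k, 'c, 'c) tensor" and \<epsilon> :: "'c \<Rightarrow> 'k" +
  assumes comult_linear: "\<Delta> \<in> lin_maps K C (tensor_product K C C)"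
    and counit_linear: "\<epsilon> \<in> lin_maps K C (regular_module K)"
    and coassoc: "x \<in> carrier C \<Longrightarrow>
      tensor_assoc K C C C (tensor_map K C C (tensor_product K C C) C \<Delta> id (\<Delta> x)) =
      tensor_map K C C C (tensor_product K C C) id \<Delta> (\<Delta> x)"
    and counit_left: "x \<in> carrier C \<Longrightarrow>
      tensor_map K C C (regular_module K) C \<epsilon> id (\<Delta> x) = pure_tensor K (regular_module K) C \<one>\<^bsub>K\<^esub> x"
    and counit_right: "x \<in> carrier C \<Longrightarrow>
      tensor_map K C C C (regular_module K) id \<epsilon> (\<Delta> x) = pure_tensor K C (regular_module K) x \<one>\<^bsub>K\<^esub>"

definition rota_baxter ::
    "('k, 'r) ring_scheme \<Rightarrow> ('k, 'c, 'm) module_scheme \<Rightarrow> ('c \<Rightarrow> ('k, 'c, 'c) tensor)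
      \<Rightarrow> 'k \<Rightarrow> ('c \<Rightarrow> 'c) \<Rightarrow> bool"
  where "rota_baxter K C \<Delta> wt P \<longleftrightarrow> P \<in> lin_maps K C C \<and>
    (\<forall>x\<in>carrier C. tensor_map K C C C C P P (\<Delta> x) =
      tensor_map K C C C C id P (\<Delta> (P x)) \<oplus>\<^bsub>tensor_product K C C\<^esub>
      tensor_map K C C C C P id (\<Delta> (P x)) \<oplus>\<^bsub>tensor_product K C C\<^esub>
      wt \<odot>\<^bsub>tensor_product K C C\<^esub> \<Delta> (P x))"

definition dual_operator ::
    "('k, 'r) ring_scheme \<Rightarrow> ('k, 'c, 'm) module_scheme \<Rightarrow> 'k \<Rightarrow> ('c \<Rightarrow> 'c) \<Rightarrow> 'c \<Rightarrow> 'c"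
  where "dual_operator K C wt P x = ((\<ominus>\<^bsub>K\<^esub> wt) \<odot>\<^bsub>C\<^esub> x) \<ominus>\<^bsub>C\<^esub> P x"

end

theory Submission
  imports Defs
begin

text \<open>Put \<open>\<Phi>\<^sub>0 = (id \<otimes> P) \<Delta> + (P \<otimes> id) \<Delta> + \<lambda> \<Delta>\<close>, so that the Rota-Baxter identity reads
  \<open>(P \<otimes> P) \<Delta> = \<Phi>\<^sub>0 P\<close>. Expanding \<open>\<lambda> id + P\<close> in both factors gives
  \<open>(P' \<otimes> P') \<Delta> = \<lambda> \<Phi>\<^sub>0 + (P \<otimes> P) \<Delta>\<close> for \<open>P' = - \<lambda> id - P\<close>, for every linear \<open>P\<close>. On the other hand
  \<open>(P \<otimes> P) \<Delta> = \<Phi> P\<close> implies \<open>- \<Phi> P' = \<lambda> \<Phi> + (P \<otimes> P) \<Delta>\<close>. So \<open>\<Phi> = \<Phi>\<^sub>0\<close> satisfies both identities if \<open>P\<close>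
  is Rota-Baxter, and if \<open>\<lambda> \<noteq> 0\<close>, the two identities force \<open>\<Phi> = \<Phi>\<^sub>0\<close>.\<close>

section \<open>Calculus of linear maps between modules\<close>

lemma lin_mapsD:
  assumes "f \<in> lin_maps K M N"
  shows "x \<in> carrier M \<Longrightarrow> f x \<in> carrier N"
    and "x \<in> carrier M \<Longrightarrow> y \<in> carrier M \<Longrightarrow> f (x \<oplus>\<^bsub>M\<^esub> y) = f x \<oplus>\<^bsub>N\<^esub> f y"
    and "a \<in> carrier K \<Longrightarrow> x \<in> carrier M \<Longrightarrow> f (a \<odot>\<^bsub>M\<^esub> x) = a \<odot>\<^bsub>N\<^esub> f x"
  using assms by (auto simp: lin_maps_def)

lemma lin_maps_id: "id \<in> lin_maps K M M" "(\<lambda>x. x) \<in> lin_maps K M M"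
  by (auto simp: lin_maps_def)

lemma lin_maps_compose:
  "f \<in> lin_maps K M N \<Longrightarrow> g \<in> lin_maps K N L \<Longrightarrow> (\<lambda>x. g (f x)) \<in> lin_maps K M L"
  by (auto simp: lin_maps_def Pi_iff)

lemma lin_maps_add:
  assumes "module K N" "f \<in> lin_maps K M N" "g \<in> lin_maps K M N"
  shows "(\<lambda>x. f x \<oplus>\<^bsub>N\<^esub> g x) \<in> lin_maps K M N"
proof -
  interpret N: module K N by fact
  note [simp] = lin_mapsD[OF assms(2)] lin_mapsD[OF assms(3)]
  show ?thesis by (auto simp: lin_maps_def N.smult_r_distr N.M.a_ac)
qed

lemma lin_maps_smult:
  assumes "module K N" "f \<in> lin_maps K M N" "a \<in> carrier K"
  shows "(\<lambda>x. a \<odot>\<^bsub>N\<^esub> f x) \<in> lin_maps K M N"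
proof -
  interpret N: module K N by fact
  note [simp] = lin_mapsD[OF assms(2)]
  \<comment> \<open>Homogeneity of the scaled map comes down to swapping two scalars, which is
    commutativity of \<open>K\<close>.\<close>
  have "a \<odot>\<^bsub>N\<^esub> (b \<odot>\<^bsub>N\<^esub> y) = b \<odot>\<^bsub>N\<^esub> (a \<odot>\<^bsub>N\<^esub> y)" if "b \<in> carrier K" "y \<in> carrier N" for b y
    using that assms(3) by (simp add: N.smult_assoc1[symmetric] N.R.m_comm)
  then show ?thesis using assms(3) by (auto simp: lin_maps_def N.smult_r_distr)
qed

text \<open>Negation is scaling by -1, so homogeneity of \<open>f\<close> gives the claim.\<close>

lemma lin_maps_uminus:
  assumes "module K M" "module K N" "f \<in> lin_maps K M N" "x \<in> carrier M"
  shows "f (\<ominus>\<^bsub>M\<^esub> x) = \<ominus>\<^bsub>N\<^esub> f x"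
proof -
  interpret M: module K M by fact
  interpret N: module K N by fact
  note [simp] = lin_mapsD[OF assms(3)]
  have "f ((\<ominus>\<^bsub>K\<^esub> \<one>\<^bsub>K\<^esub>) \<odot>\<^bsub>M\<^esub> x) = (\<ominus>\<^bsub>K\<^esub> \<one>\<^bsub>K\<^esub>) \<odot>\<^bsub>N\<^esub> f x" using assms(4) by simp
  then show ?thesis using assms(4) by (simp add: M.smult_l_minus N.smult_l_minus)
qed

section \<open>Pure tensors and tensor products of linear maps\<close>

context tensor_pair
begin

text \<open>Bilinearity in the form of rewrite rules, for multiplying out tensors of sums. The two
  rules for negation come from linearity in each slot with the other one fixed.\<close>

lemma pure_tensor_simps:
  shows "x \<in> carrier M \<Longrightarrow> x' \<in> carrier M \<Longrightarrow> y \<in> carrier N \<Longrightarrow>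
      (x \<oplus>\<^bsub>M\<^esub> x') \<otimes>\<^sub>T y = x \<otimes>\<^sub>T y \<oplus>\<^bsub>T\<^esub> x' \<otimes>\<^sub>T y"
    and "x \<in> carrier M \<Longrightarrow> y \<in> carrier N \<Longrightarrow> y' \<in> carrier N \<Longrightarrow>
      x \<otimes>\<^sub>T (y \<oplus>\<^bsub>N\<^esub> y') = x \<otimes>\<^sub>T y \<oplus>\<^bsub>T\<^esub> x \<otimes>\<^sub>T y'"
    and "a \<in> carrier K \<Longrightarrow> x \<in> carrier M \<Longrightarrow> y \<in> carrier N \<Longrightarrow>
      (a \<odot>\<^bsub>M\<^esub> x) \<otimes>\<^sub>T y = a \<odot>\<^bsub>T\<^esub> (x \<otimes>\<^sub>T y)"
    and "a \<in> carrier K \<Longrightarrow> x \<in> carrier M \<Longrightarrow> y \<in> carrier N \<Longrightarrow>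
      x \<otimes>\<^sub>T (a \<odot>\<^bsub>N\<^esub> y) = a \<odot>\<^bsub>T\<^esub> (x \<otimes>\<^sub>T y)"
    and "x \<in> carrier M \<Longrightarrow> y \<in> carrier N \<Longrightarrow>
      (\<ominus>\<^bsub>M\<^esub> x) \<otimes>\<^sub>T y = \<ominus>\<^bsub>T\<^esub> (x \<otimes>\<^sub>T y)"
    and "x \<in> carrier M \<Longrightarrow> y \<in> carrier N \<Longrightarrow>
      x \<otimes>\<^sub>T (\<ominus>\<^bsub>N\<^esub> y) = \<ominus>\<^bsub>T\<^esub> (x \<otimes>\<^sub>T y)"
proof -
  have l: "(\<lambda>x. x \<otimes>\<^sub>T y) \<in> lin_maps K M T" if "y \<in> carrier N" for y
    using pure_bilinear that by (auto simp: bilinear_maps_def)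
  have r: "pure_tensor K M N x \<in> lin_maps K N T" if "x \<in> carrier M" for x
    using pure_bilinear that by (auto simp: bilinear_maps_def)
  show "x \<in> carrier M \<Longrightarrow> x' \<in> carrier M \<Longrightarrow> y \<in> carrier N \<Longrightarrow>
      (x \<oplus>\<^bsub>M\<^esub> x') \<otimes>\<^sub>T y = x \<otimes>\<^sub>T y \<oplus>\<^bsub>T\<^esub> x' \<otimes>\<^sub>T y"
    and "x \<in> carrier M \<Longrightarrow> y \<in> carrier N \<Longrightarrow> y' \<in> carrier N \<Longrightarrow>
      x \<otimes>\<^sub>T (y \<oplus>\<^bsub>N\<^esub> y') = x \<otimes>\<^sub>T y \<oplus>\<^bsub>T\<^esub> x \<otimes>\<^sub>T y'"
    and "a \<in> carrier K \<Longrightarrow> x \<in> carrier M \<Longrightarrow> y \<in> carrier N \<Longrightarrow>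
      (a \<odot>\<^bsub>M\<^esub> x) \<otimes>\<^sub>T y = a \<odot>\<^bsub>T\<^esub> (x \<otimes>\<^sub>T y)"
    and "a \<in> carrier K \<Longrightarrow> x \<in> carrier M \<Longrightarrow> y \<in> carrier N \<Longrightarrow>
      x \<otimes>\<^sub>T (a \<odot>\<^bsub>N\<^esub> y) = a \<odot>\<^bsub>T\<^esub> (x \<otimes>\<^sub>T y)"
    and "x \<in> carrier M \<Longrightarrow> y \<in> carrier N \<Longrightarrow>
      (\<ominus>\<^bsub>M\<^esub> x) \<otimes>\<^sub>T y = \<ominus>\<^bsub>T\<^esub> (x \<otimes>\<^sub>T y)"
    and "x \<in> carrier M \<Longrightarrow> y \<in> carrier N \<Longrightarrow>
      x \<otimes>\<^sub>T (\<ominus>\<^bsub>N\<^esub> y) = \<ominus>\<^bsub>T\<^esub> (x \<otimes>\<^sub>T y)"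
    using lin_mapsD[OF l] lin_mapsD[OF r] lin_maps_uminus[OF M.module_axioms tensor_module l]
      lin_maps_uminus[OF N.module_axioms tensor_module r] by simp_all
qed

text \<open>The universal property applies, because linearity of \<open>f\<close> and
  \<open>g\<close> makes \<open>f x\<close> tensor \<open>g y\<close> bilinear in \<open>x\<close>
  and \<open>y\<close>.\<close>

lemma tensor_map:
  assumes "tensor_pair K M' N'" "f \<in> lin_maps K M M'" "g \<in> lin_maps K N N'"
  shows "tensor_map K M N M' N' f g \<in> lin_maps K T (tensor_product K M' N')"
    and "x \<in> carrier M \<Longrightarrow> y \<in> carrier N \<Longrightarrow>
      tensor_map K M N M' N' f g (x \<otimes>\<^sub>T y) = pure_tensor K M' N' (f x) (g y)"
proof -
  interpret T': tensor_pair K M' N' by fact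
  note fg = lin_mapsD[OF assms(2)] lin_mapsD[OF assms(3)]
  have b: "(\<lambda>x y. pure_tensor K M' N' (f x) (g y)) \<in> bilinear_maps K M N T'.T"
    by (auto simp: bilinear_maps_def lin_maps_def fg T'.pure_tensor_simps)
  show "tensor_map K M N M' N' f g \<in> lin_maps K T T'.T"
    and "x \<in> carrier M \<Longrightarrow> y \<in> carrier N \<Longrightarrow>
      tensor_map K M N M' N' f g (x \<otimes>\<^sub>T y) = pure_tensor K M' N' (f x) (g y)"
    unfolding tensor_map_def using tensor_lift[OF T'.tensor_module b] by blast+
qed

end

section \<open>The operator - \<lambda> id - P and its tensor square\<close>

lemma dual_operator_eq:
  assumes "module K C" "wt \<in> carrier K" "P \<in> lin_maps K C C" "x \<in> carrier C"
  shows "dual_operator K C wt P x = \<ominus>\<^bsub>C\<^esub> (wt \<odot>\<^bsub>C\<^esub> x \<oplus>\<^bsub>C\<^esub> P x)"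
proof -
  interpret C: module K C by fact
  show ?thesis using assms(2,4) lin_mapsD(1)[OF assms(3)]
    by (simp add: dual_operator_def C.M.minus_eq C.M.minus_add C.smult_l_minus)
qed

lemma dual_operator_linear:
  assumes "module K C" "wt \<in> carrier K" "P \<in> lin_maps K C C"
  shows "dual_operator K C wt P \<in> lin_maps K C C"
proof -
  interpret C: module K C by fact
  have "(\<lambda>x. wt \<odot>\<^bsub>C\<^esub> x \<oplus>\<^bsub>C\<^esub> P x) \<in> lin_maps K C C"
    by (intro lin_maps_add lin_maps_smult lin_maps_id assms)
  from lin_mapsD[OF this] show ?thesis
    by (auto simp: lin_maps_def dual_operator_eq[OF assms] C.M.minus_add C.smult_r_minus)
qed

text \<open>Composed with \<open>\<Delta>\<close>, this is the map \<open>\<Phi>\<^sub>0\<close> of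
  the overview. Taking an arbitrary tensor as argument in place of \<open>\<Delta> x\<close> allows
  identities to be checked on pure tensors.\<close>

definition rota_baxter_rhs ::
    "('k, 'r) ring_scheme \<Rightarrow> ('k, 'c, 'm) module_scheme \<Rightarrow> ('c \<Rightarrow> 'c) \<Rightarrow> 'k
      \<Rightarrow> ('k, 'c, 'c) tensor \<Rightarrow> ('k, 'c, 'c) tensor"
  where "rota_baxter_rhs K C P wt t =
    tensor_map K C C C C id P t \<oplus>\<^bsub>tensor_product K C C\<^esub>
    tensor_map K C C C C P id t \<oplus>\<^bsub>tensor_product K C C\<^esub>
    wt \<odot>\<^bsub>tensor_product K C C\<^esub> t"

lemma rota_baxter_rhs_linear:
  assumes "tensor_pair K C C" "wt \<in> carrier K" "P \<in> lin_maps K C C"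
  shows "rota_baxter_rhs K C P wt \<in> lin_maps K (tensor_product K C C) (tensor_product K C C)"
proof -
  interpret tensor_pair K C C by fact
  show ?thesis unfolding rota_baxter_rhs_def[abs_def]
    by (intro lin_maps_add lin_maps_smult lin_maps_id tensor_map tensor_module assms)
qed

text \<open>Both sides are linear in \<open>t\<close>, so agreement on pure tensors
  suffices.\<close>

lemma tensor_map_dual_operator:
  assumes "tensor_pair K C C" "wt \<in> carrier K" "P \<in> lin_maps K C C"
    and t: "t \<in> carrier (tensor_product K C C)"
  defines "D \<equiv> dual_operator K C wt P"
  shows "tensor_map K C C C C D D t =
    wt \<odot>\<^bsub>tensor_product K C C\<^esub> rota_baxter_rhs K C P wt t \<oplus>\<^bsub>tensor_product K C C\<^esub>
    tensor_map K C C C C P P t"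
proof -
  interpret tensor_pair K C C by fact
  note P = lin_mapsD(1)[OF assms(3)]
  note D = dual_operator_linear[OF M.module_axioms assms(2,3), folded D_def]
  note D_eq = dual_operator_eq[OF M.module_axioms assms(2,3), folded D_def]
  show ?thesis
  proof (rule tensor_ext[OF tensor_module _ _ _ t])
    show "tensor_map K C C C C D D \<in> lin_maps K T T" by (intro tensor_map assms D)
    show "(\<lambda>t. wt \<odot>\<^bsub>T\<^esub> rota_baxter_rhs K C P wt t \<oplus>\<^bsub>T\<^esub> tensor_map K C C C C P P t) \<in> lin_maps K T T"
      by (intro lin_maps_add lin_maps_smult rota_baxter_rhs_linear tensor_map tensor_module assms)
    fix x y assume xy: "x \<in> carrier C" "y \<in> carrier C"
    show "tensor_map K C C C C D D (pure_tensor K C C x y) =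
      wt \<odot>\<^bsub>T\<^esub> rota_baxter_rhs K C P wt (pure_tensor K C C x y) \<oplus>\<^bsub>T\<^esub>
      tensor_map K C C C C P P (pure_tensor K C C x y)"
      \<comment> \<open>The signs of the two factors \<open>D x\<close> and \<open>D y\<close>
        cancel. Of the four terms in the product of \<open>wt x + P x\<close> and
        \<open>wt y + P y\<close>, the three containing \<open>wt\<close> form \<open>wt\<close>
        times \<open>rota_baxter_rhs\<close>, and the fourth is the tensor of \<open>P x\<close> and
        \<open>P y\<close>.\<close>
      using xy P assms(2)
      by (simp add: rota_baxter_rhs_def tensor_map(2)[OF assms(1) D D]
          tensor_map(2)[OF assms(1)] assms(3) lin_maps_id D_eq pure_tensor_simps
          T.smult_r_distr T.smult_r_minus T.M.minus_add T.M.a_ac)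
  qed
qed

text \<open>The outer sign cancels the one in \<open>dual_operator_eq\<close>. If
  \<open>\<Phi> (P x)\<close> is the value of P \<otimes> P at \<open>\<Delta> x\<close>, the
  right-hand side has the shape of \<open>tensor_map_dual_operator\<close>, ready for
  comparison.\<close>

lemma lin_maps_dual_operator:
  assumes "module K C" "module K N" "wt \<in> carrier K" "P \<in> lin_maps K C C"
    and "\<Phi> \<in> lin_maps K C N" "x \<in> carrier C"
  shows "\<ominus>\<^bsub>N\<^esub> \<Phi> (dual_operator K C wt P x) = wt \<odot>\<^bsub>N\<^esub> \<Phi> x \<oplus>\<^bsub>N\<^esub> \<Phi> (P x)"
proof -
  interpret C: module K C by fact
  interpret N: module K N by fact
  show ?thesis using assms(3,6) lin_mapsD(1)[OF assms(4)] lin_mapsD[OF assms(5)]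
    by (simp add: dual_operator_eq[OF assms(1,3,4)] lin_maps_uminus[OF assms(1,2,5)])
qed

text \<open>A nonzero scalar of a field is invertible. The converse direction uses this to divide by
  the weight.\<close>

lemma module_smult_cancel:
  assumes "field K" "module K N" "a \<in> carrier K" "a \<noteq> \<zero>\<^bsub>K\<^esub>"
    and "x \<in> carrier N" "y \<in> carrier N" "a \<odot>\<^bsub>N\<^esub> x = a \<odot>\<^bsub>N\<^esub> y"
  shows "x = y"
proof -
  interpret field K by fact
  interpret N: module K N by fact
  have "a \<in> Units K" using assms(3,4) by (simp add: field_Units)
  then have "inv\<^bsub>K\<^esub> a \<odot>\<^bsub>N\<^esub> (a \<odot>\<^bsub>N\<^esub> z) = z" if "z \<in> carrier N" for z
    using that assms(3) by (simp add: N.smult_assoc1[symmetric])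
  then show ?thesis using assms(5-7) by metis
qed

section \<open>Existence of \<Phi>, and its uniqueness for nonzero weight\<close>

theorem proposition3p10:
  fixes K :: "('k, 'r) ring_scheme" and C :: "('k, 'c, 'm) module_scheme"
    and \<Delta> :: "'c \<Rightarrow> ('k, 'c, 'c) tensor" and \<epsilon> :: "'c \<Rightarrow> 'k"
    and wt :: 'k and P :: "'c \<Rightarrow> 'c"
  assumes "field K" and "char_zero K"
    and "coalgebra K C \<Delta> \<epsilon>"
    and "wt \<in> carrier K"
    and "P \<in> lin_maps K C C"
  shows "(rota_baxter K C \<Delta> wt P \<longrightarrow>
      (\<exists>\<Phi> \<in> lin_maps K C (tensor_product K C C).
        (\<forall>x\<in>carrier C. tensor_map K C C C C P P (\<Delta> x) = \<Phi> (P x)) \<and>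
        (\<forall>x\<in>carrier C.
          tensor_map K C C C C (dual_operator K C wt P) (dual_operator K C wt P) (\<Delta> x) =
          \<ominus>\<^bsub>tensor_product K C C\<^esub> \<Phi> (dual_operator K C wt P x))))
    \<and> (wt \<noteq> \<zero>\<^bsub>K\<^esub> \<longrightarrow>
      (\<exists>\<Phi> \<in> lin_maps K C (tensor_product K C C).
        (\<forall>x\<in>carrier C. tensor_map K C C C C P P (\<Delta> x) = \<Phi> (P x)) \<and>
        (\<forall>x\<in>carrier C.
          tensor_map K C C C C (dual_operator K C wt P) (dual_operator K C wt P) (\<Delta> x) =
          \<ominus>\<^bsub>tensor_product K C C\<^esub> \<Phi> (dual_operator K C wt P x))) \<longrightarrow>
      rota_baxter K C \<Delta> wt P)"
proof -
  interpret coalgebra K C \<Delta> \<epsilon> by fact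
  interpret tensor_pair K C C by (intro tensor_pair.intro C.module_axioms)
  note wt = assms(4) and P = assms(5)
  note Px = lin_mapsD(1)[OF P]
  note \<Delta>x = lin_mapsD(1)[OF comult_linear]
  let ?\<Phi>\<^sub>0 = "\<lambda>x. rota_baxter_rhs K C P wt (\<Delta> x)"
  let ?D = "dual_operator K C wt P"
  let ?PP = "tensor_map K C C C C P P" and ?DD = "tensor_map K C C C C ?D ?D"
  have \<Phi>\<^sub>0: "?\<Phi>\<^sub>0 \<in> lin_maps K C T"
    by (rule lin_maps_compose[OF comult_linear rota_baxter_rhs_linear[OF tensor_pair_axioms wt P]])
  have RB: "rota_baxter K C \<Delta> wt P \<longleftrightarrow> (\<forall>x\<in>carrier C. ?PP (\<Delta> x) = ?\<Phi>\<^sub>0 (P x))"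
    using P by (simp add: rota_baxter_def rota_baxter_rhs_def)
  have DD: "?DD (\<Delta> x) = wt \<odot>\<^bsub>T\<^esub> ?\<Phi>\<^sub>0 x \<oplus>\<^bsub>T\<^esub> ?PP (\<Delta> x)" if "x \<in> carrier C" for x
    by (rule tensor_map_dual_operator[OF tensor_pair_axioms wt P \<Delta>x[OF that]])
  note D_eq = lin_maps_dual_operator[OF C.module_axioms tensor_module wt P]
  have PPx: "?PP (\<Delta> x) \<in> carrier T" if "x \<in> carrier C" for x
    using lin_mapsD(1)[OF tensor_map(1)[OF tensor_pair_axioms P P] \<Delta>x[OF that]] .
  have "?\<Phi>\<^sub>0 x = \<Phi> x"
    if "wt \<noteq> \<zero>\<^bsub>K\<^esub>" and \<Phi>: "\<Phi> \<in> lin_maps K C T" and "x \<in> carrier C"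
      and "?PP (\<Delta> x) = \<Phi> (P x)" "?DD (\<Delta> x) = \<ominus>\<^bsub>T\<^esub> \<Phi> (?D x)" for \<Phi> x
  proof (rule module_smult_cancel[OF assms(1) tensor_module wt])
    \<comment> \<open>Both sides equal \<open>?DD (\<Delta> x)\<close>: the left one by
      \<open>DD\<close>, the right one by the second identity for \<open>\<Phi>\<close> together
      with \<open>\<Phi> (P x) = ?PP (\<Delta> x)\<close>.\<close>
    have "wt \<odot>\<^bsub>T\<^esub> ?\<Phi>\<^sub>0 x \<oplus>\<^bsub>T\<^esub> ?PP (\<Delta> x) = wt \<odot>\<^bsub>T\<^esub> \<Phi> x \<oplus>\<^bsub>T\<^esub> ?PP (\<Delta> x)"
      using that DD D_eq[OF \<Phi>] by simp
    then show "wt \<odot>\<^bsub>T\<^esub> ?\<Phi>\<^sub>0 x = wt \<odot>\<^bsub>T\<^esub> \<Phi> x"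
      using that(3) wt PPx lin_mapsD(1)[OF \<Phi>] lin_mapsD(1)[OF \<Phi>\<^sub>0]
      by (simp add: T.M.add.right_cancel)
  qed (use that lin_mapsD(1)[OF \<Phi>] lin_mapsD(1)[OF \<Phi>\<^sub>0] in simp_all)
  note uniq = this
  show ?thesis
  proof (intro conjI impI)
    assume "rota_baxter K C \<Delta> wt P"
    then show "\<exists>\<Phi>\<in>lin_maps K C T. (\<forall>x\<in>carrier C. ?PP (\<Delta> x) = \<Phi> (P x)) \<and>
        (\<forall>x\<in>carrier C. ?DD (\<Delta> x) = \<ominus>\<^bsub>T\<^esub> \<Phi> (?D x))"
      \<comment> \<open>For the witness \<open>?\<Phi>\<^sub>0\<close>, the first identity is
        \<open>RB\<close>. The second compares \<open>DD\<close> with \<open>D_eq\<close>, whose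
        last summands agree by \<open>RB\<close>.\<close>
      by (intro bexI[OF _ \<Phi>\<^sub>0]) (simp add: RB DD D_eq[OF \<Phi>\<^sub>0])
  next
    assume "wt \<noteq> \<zero>\<^bsub>K\<^esub>" "\<exists>\<Phi>\<in>lin_maps K C T. (\<forall>x\<in>carrier C. ?PP (\<Delta> x) = \<Phi> (P x)) \<and>
        (\<forall>x\<in>carrier C. ?DD (\<Delta> x) = \<ominus>\<^bsub>T\<^esub> \<Phi> (?D x))"
    \<comment> \<open>Uniqueness is applied at the point \<open>P x\<close>: there
      \<open>?\<Phi>\<^sub>0\<close> and \<open>\<Phi>\<close> agree, and
      \<open>\<Phi> (P x)\<close> is \<open>?PP (\<Delta> x)\<close>.\<close>
    then show "rota_baxter K C \<Delta> wt P" using uniq Px unfolding RB by metis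
  qed
qed

end
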